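(* Let $G\ge 1$ and consider $G$ classical clockworks $C_1,\dots,C_G$ of dimension two together with a feedback policy $\Pi=(\mathcal{M},\upsilon,\gamma)$ such that for every $a=1,\dots,G$ the parameter space is $\mathcal{G}^{a}=\tilde{\mathcal{G}}^{a}\times\tilde{\mathcal{G}}^{a}$ for some $\{0\}\neq\tilde{\mathcal{G}}^{a}\subset\mathbb{R}_{\ge 0}$. Then there exist a constant feedback policy $\Pi'$ for the same clockworks, with the same parameter spaces $\mathcal{G}^a$, and an integrated current $N'(t)$ for the joint system operated under $\Pi'$ and initialized in a steady state, whose asymptotic signal-to-noise ratio $\mathfrak{S}'$ is $$\mathfrak{S}'\;=\;\max_{m\in\mathcal{M}}\Bigl(\max_{(i_1,\dots,i_G)\in\{0,1\}^G}\ \sum_{a=1}^{G}\gamma^{(a)}_{i_a}(m)\Bigr).$$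
   Context: Classical clockwork of dimension two. Clockwork $C_a$ has two states $0,1$ and remains diagonal in a fixed orthonormal basis $\{|0\rangle,|1\rangle\}$ at all times. Its dynamics is given by a trivial Hamiltonian and jump operators $J_{C_a,0}=\sqrt{\Gamma^{(a)}_0}\,|1\rangle\langle 0|$ and $J_{C_a,1}=\sqrt{\Gamma^{(a)}_1}\,|0\rangle\langle 1|$. That is, it jumps from state $i$ to state $i\oplus 1$ (addition modulo two) at rate $\Gamma^{(a)}_i$. A jump of clockwork $C_a$ out of state $i$ is called a jump of type $(a,i)$, and $\mathcal{J}_a=\{(a,0),(a,1)\}$ is the set of jump types of $C_a$. The control parameters of $C_a$ are the pair of rates $(\Gamma^{(a)}_0,\Gamma^{(a)}_1)$, ranging over the parameter space $\mathcal{G}^a$. Feedback policy. A feedback policy $\Pi=(\mathcal{M},\upsilon,\gamma)$ consists of - a finite (non-empty) set $\mathcal{M}$ of memory states, - a memory-update function $\upsilon:\mathcal{M}\times\bigcup_{a=1}^G\mathcal{J}_a\to\mathcal{M}$, and - parameter-update functions $\gamma=\{\gamma^{(a)}\}_{a=1}^G$ with $\gamma^{(a)}:\mathcal{M}\to\mathcal{G}^a$. We write $\gamma^{(a)}(m)=(\gamma^{(a)}_0(m),\gamma^{(a)}_1(m))$. When the memory is in state $m$, clockwork $C_a$ is operated with rates $\Gamma^{(a)}_i=\gamma^{(a)}_i(m)$. When a jump of type $(a,i)$ occurs, the memory is immediately updated from $m$ to $\upsilon(m,(a,i))$. A feedback policy is constant if its memory state space is trivial, $\mathcal{M}=\{0\}$;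 the clockworks are then operated at one fixed choice of parameters for all times. Joint dynamics. Under a feedback policy, the joint system of clockworks and memory is a continuous-time Markov chain on $\{0,1\}^G\times\mathcal{M}$. From state $(x,m)$ with $x=(x^{(1)},\dots,x^{(G)})$, for each $a$, it jumps at rate $\gamma^{(a)}_{x^{(a)}}(m)$ to $(x\oplus\mathbb{1}^{(a)},\,\upsilon(m,(a,x^{(a)})))$, where $\mathbb{1}^{(a)}$ is the $a$-th unit vector and $\oplus$ is entrywise addition modulo two. A steady state is a stationary distribution of this chain. Integrated current. An integrated current is a random variable $$N(t)=\sum_{a=1}^G\sum_{i\in\{0,1\}}\sum_{m\in\mathcal{M}} w^{(a)}_{i,m}N^{(a)}_{i,m}(t)$$ with real weights $w^{(a)}_{i,m}$, where $N^{(a)}_{i,m}(t)$ counts the jumps of type $(a,i)$ occurring up to time $t$ while the memory was in state $m$ immediately before the jump. (For a constant policy, $m$ takes only the value $0$.) Signal-to-noise ratio. $\mathfrak{S}=\lim_{t\to\infty}\mathfrak{S}(t)$ with $$\mathfrak{S}(t)=\frac{\bigl(\frac{d}{dt}\mathbb{E}_t[N]\bigr)^2}{\mathrm{Var}_t[N]/t},$$ where $\mathbb{E}_t[N]$ and $\mathrm{Var}_t[N]$ are the mean and variance of $N(t)$; the degenerate quotient $0/0$ is read as $0$. *)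

theory Defs
  imports "HOL-Probability.Probability" "HOL-Library.Z2"
begin

text \<open>
  The clockworks are indexed by a finite type \<open>'g\<close> (so \<open>G = CARD('g) \<ge> 1\<close>), and the two
  states of each of them by the type \<open>bit\<close>, whose addition is addition modulo two.
  A jump type \<open>(a, i)\<close> is a jump of clockwork \<open>a\<close> out of state \<open>i\<close>.
\<close>

instance bit :: finite
proof
  have "(UNIV :: bit set) = {0, 1}"
    using bit_not_zero_iff by blast
  then show "finite (UNIV :: bit set)"
    by (metis finite.intros)
qed

record ('g, 'm) policy =
  mem :: "'m set"
  upd :: "'m \<Rightarrow> 'g \<times> bit \<Rightarrow> 'm"
  par :: "'g \<Rightarrow> 'm \<Rightarrow> real \<times> real"

definition feedback_policy :: "('g \<Rightarrow> (real \<times> real) set) \<Rightarrow> ('g, 'm) policy \<Rightarrow> bool" where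
  "feedback_policy \<G> \<pi> \<longleftrightarrow>
     finite (mem \<pi>) \<and> mem \<pi> \<noteq> {} \<and>
     (\<forall>m \<in> mem \<pi>. \<forall>j. upd \<pi> m j \<in> mem \<pi>) \<and>
     (\<forall>a. \<forall>m \<in> mem \<pi>. par \<pi> a m \<in> \<G> a)"

definition constant_policy :: "('g, 'm::zero) policy \<Rightarrow> bool" where
  "constant_policy \<pi> \<longleftrightarrow> mem \<pi> = {0}"

definition rate :: "('g, 'm) policy \<Rightarrow> 'g \<Rightarrow> bit \<Rightarrow> 'm \<Rightarrow> real" where
  "rate \<pi> a i m = (if i = 0 then fst (par \<pi> a m) else snd (par \<pi> a m))"

type_synonym ('g, 'm) state = "('g \<Rightarrow> bit) \<times> 'm"

definition jump :: "('g, 'm) policy \<Rightarrow> 'g \<Rightarrow> ('g, 'm) state \<Rightarrow> ('g, 'm) state" where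
  "jump \<pi> a z = ((fst z)(a := fst z a + 1), upd \<pi> (snd z) (a, fst z a))"


text \<open>
  The joint continuous-time Markov chain is realized by competing exponential clocks.
  An outcome consists of an initial state \<open>z\<^sub>0\<close> and of independent standard exponential
  variables \<open>e n a\<close>. If the chain is in state \<open>(x, m)\<close> after \<open>n\<close> jumps, clockwork \<open>a\<close> would jump
  after a further time \<open>e n a / rate \<pi> a (x a) m\<close>, which is exponentially distributed with
  parameter \<open>rate \<pi> a (x a) m\<close> (and is \<open>\<infinity>\<close> if that rate is zero). The clockwork with the shortest
  waiting time jumps, whereupon all waiting times are drawn afresh; by memorylessness this gives
  the Markov chain that jumps from \<open>z = (x, m)\<close> to \<open>jump \<pi> a z\<close> at rate \<open>rate \<pi> a (x a) m\<close>.
\<close>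

definition trajectory_space ::
  "('g, 'm) state pmf \<Rightarrow> (('g, 'm) state \<times> (nat \<Rightarrow> 'g \<Rightarrow> real)) measure" where
  "trajectory_space p =
     measure_pmf p \<Otimes>\<^sub>M
       (\<Pi>\<^sub>M n \<in> UNIV. \<Pi>\<^sub>M a \<in> UNIV. density lborel (exponential_density 1))"

definition waiting_time ::
  "('g, 'm) policy \<Rightarrow> ('g, 'm) state \<Rightarrow> ('g \<Rightarrow> real) \<Rightarrow> 'g \<Rightarrow> ereal" where
  "waiting_time \<pi> z e a =
     (let r = rate \<pi> a (fst z a) (snd z) in if r > 0 then ereal (e a / r) else \<infinity>)"

text \<open>
  Ties occur with probability zero, except in a state with all rates zero. Such a state is never
  left: the next and all later jump times are then \<open>\<infinity>\<close>, and the choice made here is immaterial.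
\<close>

definition next_clockwork :: "('g, 'm) policy \<Rightarrow> ('g, 'm) state \<Rightarrow> ('g \<Rightarrow> real) \<Rightarrow> 'g" where
  "next_clockwork \<pi> z e = (ARG_MIN (waiting_time \<pi> z e) a. True)"

primrec jump_chain ::
  "('g, 'm) policy \<Rightarrow> ('g, 'm) state \<times> (nat \<Rightarrow> 'g \<Rightarrow> real) \<Rightarrow> nat \<Rightarrow> ('g, 'm) state" where
  "jump_chain \<pi> \<omega> 0 = fst \<omega>"
| "jump_chain \<pi> \<omega> (Suc n) =
     jump \<pi> (next_clockwork \<pi> (jump_chain \<pi> \<omega> n) (snd \<omega> n)) (jump_chain \<pi> \<omega> n)"

text \<open>
  \<open>jump_time \<pi> \<omega> n\<close> is the time of the jump from \<open>jump_chain \<pi> \<omega> n\<close> to \<open>jump_chain \<pi> \<omega> (Suc n)\<close>.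
\<close>

definition jump_time ::
  "('g::finite, 'm) policy \<Rightarrow> ('g, 'm) state \<times> (nat \<Rightarrow> 'g \<Rightarrow> real) \<Rightarrow> nat \<Rightarrow> ereal" where
  "jump_time \<pi> \<omega> n = (\<Sum>k\<le>n. MIN a. waiting_time \<pi> (jump_chain \<pi> \<omega> k) (snd \<omega> k) a)"

text \<open>
  Almost surely there are only finitely many jumps up to any time, so that the cardinalities
  below are meaningful.
\<close>

definition state_at ::
  "('g::finite, 'm) policy \<Rightarrow> real \<Rightarrow> ('g, 'm) state \<times> (nat \<Rightarrow> 'g \<Rightarrow> real) \<Rightarrow> ('g, 'm) state" where
  "state_at \<pi> t \<omega> = jump_chain \<pi> \<omega> (card {n. jump_time \<pi> \<omega> n \<le> ereal t})"

definition jump_count ::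
  "('g::finite, 'm) policy \<Rightarrow> 'g \<Rightarrow> bit \<Rightarrow> 'm \<Rightarrow> real \<Rightarrow>
     ('g, 'm) state \<times> (nat \<Rightarrow> 'g \<Rightarrow> real) \<Rightarrow> nat" where
  "jump_count \<pi> a i m t \<omega> =
     card {n. jump_time \<pi> \<omega> n \<le> ereal t \<and>
              next_clockwork \<pi> (jump_chain \<pi> \<omega> n) (snd \<omega> n) = a \<and>
              fst (jump_chain \<pi> \<omega> n) a = i \<and> snd (jump_chain \<pi> \<omega> n) = m}"

definition integrated_current ::
  "('g::finite, 'm) policy \<Rightarrow> ('g \<Rightarrow> bit \<Rightarrow> 'm \<Rightarrow> real) \<Rightarrow> real \<Rightarrow>
     ('g, 'm) state \<times> (nat \<Rightarrow> 'g \<Rightarrow> real) \<Rightarrow> real" where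
  "integrated_current \<pi> w t \<omega> =
     (\<Sum>a\<in>UNIV. \<Sum>i\<in>{0, 1}. \<Sum>m\<in>mem \<pi>. w a i m * real (jump_count \<pi> a i m t \<omega>))"

definition steady_state :: "('g::finite, 'm) policy \<Rightarrow> ('g, 'm) state pmf \<Rightarrow> bool" where
  "steady_state \<pi> p \<longleftrightarrow>
     set_pmf p \<subseteq> UNIV \<times> mem \<pi> \<and>
     (\<forall>t\<ge>0. distr (trajectory_space p) (count_space UNIV) (state_at \<pi> t) = measure_pmf p)"


text \<open>
  The quotient is taken in \<open>ereal\<close>, where \<open>0 / 0 = 0\<close> and \<open>c / 0 = \<infinity>\<close> for \<open>c > 0\<close>.
\<close>

definition snr_at :: "'w measure \<Rightarrow> (real \<Rightarrow> 'w \<Rightarrow> real) \<Rightarrow> real \<Rightarrow> ereal" where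
  "snr_at M N t =
     ereal ((deriv (\<lambda>s. prob_space.expectation M (N s)) t)\<^sup>2) /
     ereal (prob_space.variance M (N t) / t)"

text \<open>
  The first two conditions, which hold for all integrated currents of a finite chain, only ensure
  that mean, variance and derivative are not the default values of undefined expressions.
\<close>

definition has_asymptotic_snr :: "'w measure \<Rightarrow> (real \<Rightarrow> 'w \<Rightarrow> real) \<Rightarrow> real \<Rightarrow> bool" where
  "has_asymptotic_snr M N S \<longleftrightarrow>
     (\<forall>t\<ge>0. integrable M (N t) \<and> integrable M (\<lambda>\<omega>. (N t \<omega>)\<^sup>2)) \<and>
     (\<forall>t>0. (\<lambda>s. prob_space.expectation M (N s)) differentiable (at t)) \<and>
     (snr_at M N \<longlongrightarrow> ereal S) at_top"

end

theory Submission
  imports Defs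
begin

text \<open>
  Let \<open>m\<close> and \<open>i\<close> attain the maximum and operate clockwork \<open>a\<close> with both rates equal to the rate
  \<open>\<Gamma> a\<close> of \<open>i a\<close> at \<open>m\<close>; this is admissible because the parameter space is a square. Each jump rate
  is then independent of the state, so the waiting times between jumps are independent and
  exponential with parameter \<open>R = (\<Sum>a. \<Gamma> a)\<close>. The total number of jumps up to time \<open>t\<close> is therefore
  Poisson with mean and variance \<open>R t\<close>, and its signal-to-noise ratio is \<open>R\<^sup>2 / R = R\<close>.
\<close>


subsection \<open>Poisson counts of exponential arrivals\<close>

text \<open>Elements of the product space are extensional, so \<open>restrict\<close> acts as the
  identity there and the joint law of the coordinates is \<open>PiM I M\<close> itself, the product
  of the marginals.\<close>

lemma indep_vars_PiM_component:
  assumes "\<And>i. i \<in> I \<Longrightarrow> prob_space (M i)" "I \<noteq> {}"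
  shows "prob_space.indep_vars (PiM I M) M (\<lambda>i f. f i) I"
proof -
  interpret prob_space "PiM I M"
    by (intro prob_space_PiM assms)
  have "distr (PiM I M) (PiM I M) (\<lambda>f. restrict f I) = distr (PiM I M) (PiM I M) (\<lambda>f. f)"
    by (intro distr_cong) (auto simp: space_PiM)
  also have "\<dots> = PiM I M"
    by simp
  also have "\<dots> = PiM I (\<lambda>i. distr (PiM I M) (M i) (\<lambda>f. f i))"
    by (intro PiM_cong refl distr_PiM_component[symmetric] assms) auto
  finally show ?thesis
    using assms by (subst indep_vars_iff_distr_eq_PiM') auto
qed

text \<open>Turns counting into comparing: \<open>n < card S\<close> becomes
  \<open>n \<in> S\<close>, which links the number of arrivals to a single arrival time.\<close>

lemma atMost_closed_eq_lessThan_card: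
  fixes S :: "nat set"
  assumes "finite S" "\<And>m n. m \<le> n \<Longrightarrow> n \<in> S \<Longrightarrow> m \<in> S"
  shows "S = {..<card S}"
proof (cases "S = {}")
  case False
  have "S = {..Max S}"
    using assms False by (auto intro: Max_ge Max_in)
  then show ?thesis
    by (metis card_atMost lessThan_Suc_atMost)
qed simp

text \<open>Total mass and first two moments of the Poisson distribution. The recurrence
  \<open>q_Suc\<close> gives each moment series, shifted by one index, from the preceding series;
  the omitted term at index 0 vanishes.\<close>

lemma poisson_sums:
  fixes x :: real
  shows "(\<lambda>n. x ^ n / fact n * exp (- x)) sums 1"
    and "(\<lambda>n. real n * (x ^ n / fact n * exp (- x))) sums x"
    and "(\<lambda>n. (real n)\<^sup>2 * (x ^ n / fact n * exp (- x))) sums (x\<^sup>2 + x)"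
proof -
  define q where "q n = x ^ n / fact n * exp (- x)" for n :: nat
  have "(\<lambda>n. x ^ n / fact n) sums exp x"
    using exp_converges[of x] by (simp add: field_simps)
  from sums_mult2[OF this, of "exp (- x)"] have q: "q sums 1"
    by (simp add: q_def[abs_def] exp_minus_inverse)
  have q_Suc: "real (Suc n) * q (Suc n) = x * q n" for n
    by (simp add: q_def divide_simps)
  from sums_mult[OF q, of x] have "(\<lambda>n. real (Suc n) * q (Suc n)) sums x"
    by (simp only: q_Suc) simp
  from sums_Suc[OF this] have q1: "(\<lambda>n. real n * q n) sums x"
    by simp
  have "(\<lambda>n. x * (real n * q n + q n)) sums (x * (x + 1))"
    by (intro sums_mult sums_add q q1)
  moreover have "x * (real n * q n + q n) = (real (Suc n))\<^sup>2 * q (Suc n)" for n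
  proof -
    have "(real (Suc n))\<^sup>2 * q (Suc n) = real (Suc n) * (x * q n)"
      by (simp only: power2_eq_square mult.assoc q_Suc)
    then show ?thesis
      by (simp add: algebra_simps)
  qed
  ultimately have "(\<lambda>n. (real (Suc n))\<^sup>2 * q (Suc n)) sums (x * (x + 1))"
    by simp
  from sums_Suc[OF this] have q2: "(\<lambda>n. (real n)\<^sup>2 * q n) sums (x\<^sup>2 + x)"
    by (simp add: algebra_simps power2_eq_square)
  show "(\<lambda>n. x ^ n / fact n * exp (- x)) sums 1"
    and "(\<lambda>n. real n * (x ^ n / fact n * exp (- x))) sums x"
    and "(\<lambda>n. (real n)\<^sup>2 * (x ^ n / fact n * exp (- x))) sums (x\<^sup>2 + x)"
    using q q1 q2 by (simp_all add: q_def[abs_def])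
qed

context prob_space
begin

text \<open>The law of \<open>K\<close> has density \<open>q\<close> with respect to counting
  measure, so the integral becomes a series; as \<open>f\<close> is nonnegative, its convergence is
  absolute and yields integrability.\<close>

lemma has_bochner_integral_nat_valued:
  fixes K :: "'a \<Rightarrow> nat" and f :: "nat \<Rightarrow> real"
  assumes K[measurable]: "K \<in> M \<rightarrow>\<^sub>M count_space UNIV"
    and "\<And>n. 0 \<le> f n" and s: "(\<lambda>n. f n * prob {\<omega> \<in> space M. K \<omega> = n}) sums s"
  shows "has_bochner_integral M (\<lambda>\<omega>. f (K \<omega>)) s"
proof -
  define q where "q n = prob {\<omega> \<in> space M. K \<omega> = n}" for n
  have D: "distr M (count_space UNIV) K = density (count_space UNIV) (\<lambda>n. ennreal (q n))"
  proof (rule measure_eqI_countable)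
    fix n :: nat
    have "emeasure (distr M (count_space UNIV) K) {n} = ennreal (q n)"
      by (subst emeasure_distr)
        (auto simp: q_def emeasure_eq_measure vimage_def Int_def conj_commute)
    then show "emeasure (distr M (count_space UNIV) K) {n} =
        emeasure (density (count_space UNIV) (\<lambda>n. ennreal (q n))) {n}"
      by (simp add: emeasure_density nn_integral_count_space_indicator[symmetric])
  qed auto
  have q: "0 \<le> q n" for n
    by (simp add: q_def)
  have s: "(\<lambda>n. q n * f n) sums s"
    using s by (simp add: q_def mult.commute)
  have int: "integrable (count_space UNIV) (\<lambda>n. q n * f n)"
    using s assms(2) q by (subst integrable_count_space_nat_iff) (auto simp: sums_iff)
  have "has_bochner_integral (count_space UNIV) (\<lambda>n. q n *\<^sub>R f n) s"
    using int sums_unique[OF s] integral_count_space_nat[OF int]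
    by (simp add: has_bochner_integral_iff)
  then have "has_bochner_integral (distr M (count_space UNIV) K) f s"
    unfolding D using q by (intro has_bochner_integral_density) auto
  then show ?thesis
    by (subst (asm) has_bochner_integral_iff)
      (simp add: has_bochner_integral_iff integrable_distr_eq integral_distr)
qed

lemma poisson_moments:
  fixes K :: "'a \<Rightarrow> nat"
  assumes K[measurable]: "K \<in> M \<rightarrow>\<^sub>M count_space UNIV"
    and q: "\<And>n. prob {\<omega> \<in> space M. K \<omega> = n} = x ^ n / fact n * exp (- x)"
  shows "integrable M (\<lambda>\<omega>. real (K \<omega>))" "integrable M (\<lambda>\<omega>. (real (K \<omega>))\<^sup>2)"
    and "expectation (\<lambda>\<omega>. real (K \<omega>)) = x" "variance (\<lambda>\<omega>. real (K \<omega>)) = x"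
proof -
  have 1: "has_bochner_integral M (\<lambda>\<omega>. real (K \<omega>)) x"
    using has_bochner_integral_nat_valued[of K real x] poisson_sums(2)[of x] by (simp add: q)
  have 2: "has_bochner_integral M (\<lambda>\<omega>. (real (K \<omega>))\<^sup>2) (x\<^sup>2 + x)"
    using has_bochner_integral_nat_valued[of K "\<lambda>n. (real n)\<^sup>2" "x\<^sup>2 + x"] poisson_sums(3)[of x]
    by (simp add: q)
  show "integrable M (\<lambda>\<omega>. real (K \<omega>))" "integrable M (\<lambda>\<omega>. (real (K \<omega>))\<^sup>2)"
    "expectation (\<lambda>\<omega>. real (K \<omega>)) = x"
    using 1 2 by (simp_all add: has_bochner_integral_iff)
  then show "variance (\<lambda>\<omega>. real (K \<omega>)) = x"
    using 2 by (subst variance_eq) (simp_all add: has_bochner_integral_iff)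
qed

text \<open>Almost surely \<open>n < K \<omega>\<close> means that arrival \<open>n\<close> occurs
  by time \<open>t\<close>. Arrival times are Erlang distributed, and the Erlang distribution
  function is a tail of the Poisson series.\<close>

lemma exponential_arrivals:
  fixes X :: "nat \<Rightarrow> 'a \<Rightarrow> real"
  assumes l: "0 < l" and t: "0 \<le> t"
    and X: "\<And>k. distributed M lborel (X k) (exponential_density l)"
    and indep: "indep_vars (\<lambda>_. borel) X UNIV"
  defines "K \<equiv> \<lambda>\<omega>. card {n. (\<Sum>k\<le>n. X k \<omega>) \<le> t}"
  shows "K \<in> M \<rightarrow>\<^sub>M count_space UNIV"
    and "AE \<omega> in M. finite {n. (\<Sum>k\<le>n. X k \<omega>) \<le> t}"
    and "prob {\<omega> \<in> space M. K \<omega> = n} = (l * t) ^ n / fact n * exp (- (l * t))"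
proof -
  define T where "T n \<omega> = (\<Sum>k\<le>n. X k \<omega>)" for n \<omega>
  define q where "q n = (l * t) ^ n / fact n * exp (- (l * t))" for n :: nat
  have [measurable]: "X k \<in> borel_measurable M" for k
    using X[of k] by (simp add: distributed_def)
  have [measurable]: "T n \<in> borel_measurable M" for n
    unfolding T_def by measurable
  show K[measurable]: "K \<in> M \<rightarrow>\<^sub>M count_space UNIV"
    unfolding K_def by measurable
  have T: "prob {\<omega> \<in> space M. T n \<omega> \<le> t} = 1 - (\<Sum>k\<le>n. q k)" for n
  proof -
    \<comment> \<open>Arrival \<open>n\<close> is a sum of \<open>n + 1\<close> exponential
      variables, and the index of \<open>erlang_density\<close> is one less than the number of
      summands.\<close>
    have "distributed M lborel (\<lambda>\<omega>. \<Sum>k\<in>{..n}. X k \<omega>) (erlang_density (card {..n} - 1) l)"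
      by (intro exponential_distributed_sum l X indep_vars_subset[OF indep]) auto
    then have "distributed M lborel (T n) (erlang_density n l)"
      by (simp add: T_def[abs_def])
    from erlang_distributed_le[OF this l t] show ?thesis
      using t by (simp add: erlang_CDF_def q_def)
  qed
  \<comment> \<open>Arrivals do not accumulate: this event lies in every event
    \<open>T n \<omega> \<le> t\<close>, and their probabilities are the tails of a series with sum
    1.\<close>
  have "prob {\<omega> \<in> space M. \<forall>n. T n \<omega> \<le> t} \<le> 0"
  proof (rule LIMSEQ_le_const)
    have "(\<lambda>n. \<Sum>k\<le>n. q k) \<longlonglongrightarrow> 1"
      using poisson_sums(1)[of "l * t"] by (simp add: q_def[abs_def] sums_def_le)
    then have "(\<lambda>n. 1 - (\<Sum>k\<le>n. q k)) \<longlonglongrightarrow> 1 - 1"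
      by (intro tendsto_intros)
    then show "(\<lambda>n. 1 - (\<Sum>k\<le>n. q k)) \<longlonglongrightarrow> 0"
      by simp
    have "prob {\<omega> \<in> space M. \<forall>n. T n \<omega> \<le> t} \<le> prob {\<omega> \<in> space M. T n \<omega> \<le> t}" for n
      by (intro finite_measure_mono) auto
    then show "\<exists>N. \<forall>n\<ge>N. prob {\<omega> \<in> space M. \<forall>n. T n \<omega> \<le> t} \<le> 1 - (\<Sum>k\<le>n. q k)"
      by (auto simp: T)
  qed
  then have "prob {\<omega> \<in> space M. \<forall>n. T n \<omega> \<le> t} = 0"
    by (simp add: measure_le_0_iff)
  then have "AE \<omega> in M. \<not> (\<forall>n. T n \<omega> \<le> t)"
    by (subst (asm) prob_Collect_eq_0) auto
  moreover have "AE \<omega> in M. \<forall>k. 0 < X k \<omega>"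
    unfolding AE_all_countable
  proof
    fix k
    have "prob {\<omega> \<in> space M. X k \<omega> \<le> 0} = 0"
      using exponential_distributedD_le[OF X[of k] _ l, of 0] by simp
    then show "AE \<omega> in M. 0 < X k \<omega>"
      by (subst (asm) prob_Collect_eq_0) (auto simp: not_le)
  qed
  \<comment> \<open>Finiteness is essential, since \<open>card\<close> of an infinite set is 0.
    Positive summands make \<open>T\<close> increasing in \<open>n\<close>, so the arrivals up to
    \<open>t\<close> form an initial segment.\<close>
  ultimately have AE: "AE \<omega> in M. finite {n. T n \<omega> \<le> t} \<and> (\<forall>n. n < K \<omega> \<longleftrightarrow> T n \<omega> \<le> t)"
  proof eventually_elim
    case (elim \<omega>)
    have mono: "T m \<omega> \<le> T n \<omega>" if "m \<le> n" for m n
      unfolding T_def using that elim by (intro sum_mono2) (auto intro: less_imp_le)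
    obtain N where "t < T N \<omega>"
      using elim by (auto simp: not_le)
    then have "{n. T n \<omega> \<le> t} \<subseteq> {..N}"
      using mono by (metis (lifting) atMost_iff leD le_cases mem_Collect_eq order_trans subsetI)
    then have fin: "finite {n. T n \<omega> \<le> t}"
      by (rule finite_subset) simp
    have "{n. T n \<omega> \<le> t} = {..<K \<omega>}"
      unfolding K_def T_def[symmetric]
      using fin mono by (intro atMost_closed_eq_lessThan_card) (auto intro: order_trans)
    with fin show ?case
      by auto
  qed
  then show "AE \<omega> in M. finite {n. (\<Sum>k\<le>n. X k \<omega>) \<le> t}"
    by (auto simp: T_def)
  have less: "prob {\<omega> \<in> space M. n < K \<omega>} = 1 - (\<Sum>k\<le>n. q k)" for n
    unfolding T[symmetric] using AE by (intro finite_measure_eq_AE) auto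
  show "prob {\<omega> \<in> space M. K \<omega> = n} = (l * t) ^ n / fact n * exp (- (l * t))"
  \<comment> \<open>Point masses come from the tails \<open>less\<close>: by complement at 0,
    otherwise as the difference of two nested events.\<close>
  proof (cases n)
    case 0
    have "{\<omega> \<in> space M. K \<omega> = 0} = space M - {\<omega> \<in> space M. 0 < K \<omega>}"
      by auto
    then have "prob {\<omega> \<in> space M. K \<omega> = 0} = 1 - prob {\<omega> \<in> space M. 0 < K \<omega>}"
      by (simp add: prob_compl)
    with 0 show ?thesis
      unfolding less by (simp add: q_def)
  next
    case (Suc m)
    have "{\<omega> \<in> space M. K \<omega> = Suc m} = {\<omega> \<in> space M. m < K \<omega>} - {\<omega> \<in> space M. Suc m < K \<omega>}"
      by auto
    moreover have "prob ({\<omega> \<in> space M. m < K \<omega>} - {\<omega> \<in> space M. Suc m < K \<omega>}) =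
        prob {\<omega> \<in> space M. m < K \<omega>} - prob {\<omega> \<in> space M. Suc m < K \<omega>}"
      by (rule finite_measure_Diff) (measurable, auto)
    ultimately have "prob {\<omega> \<in> space M. K \<omega> = Suc m} =
        prob {\<omega> \<in> space M. m < K \<omega>} - prob {\<omega> \<in> space M. Suc m < K \<omega>}"
      by (simp only:)
    with Suc show ?thesis
      unfolding less by (simp add: q_def)
  qed
qed

end


subsection \<open>The space of trajectories\<close>

abbreviation exp_clock :: "real measure" where
  "exp_clock \<equiv> density lborel (exponential_density 1)"

abbreviation exp_clocks :: "('g \<Rightarrow> real) measure" where
  "exp_clocks \<equiv> \<Pi>\<^sub>M a \<in> UNIV. exp_clock"

abbreviation clock_space :: "(nat \<Rightarrow> 'g \<Rightarrow> real) measure" where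
  "clock_space \<equiv> \<Pi>\<^sub>M n \<in> UNIV. exp_clocks"

lemma prob_space_exp_clock: "prob_space exp_clock"
  by (rule prob_space_exponential_density) simp

lemma prob_space_exp_clocks: "prob_space (exp_clocks :: ('g \<Rightarrow> real) measure)"
  by (intro prob_space_PiM prob_space_exp_clock)

lemma prob_space_clock_space: "prob_space (clock_space :: (nat \<Rightarrow> 'g \<Rightarrow> real) measure)"
  by (intro prob_space_PiM prob_space_exp_clocks)

lemma prob_space_trajectory_space: "prob_space (trajectory_space p)"
  unfolding trajectory_space_def
  by (intro prob_space_pair prob_space_clock_space measure_pmf.prob_space_axioms)

text \<open>Measurability depends only on the sigma-algebra, so \<open>p\<close> and the exponential
  densities can be forgotten in favour of \<open>count_space UNIV\<close> and
  \<open>borel\<close>.\<close>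

lemma sets_trajectory_space [measurable_cong]:
  "sets (trajectory_space p :: (('g, 'm) state \<times> (nat \<Rightarrow> 'g \<Rightarrow> real)) measure) =
     sets (count_space UNIV \<Otimes>\<^sub>M (\<Pi>\<^sub>M n \<in> UNIV. \<Pi>\<^sub>M a \<in> UNIV. borel))"
  unfolding trajectory_space_def by (intro sets_pair_measure_cong sets_PiM_cong) auto

lemma space_trajectory_space [simp]: "space (trajectory_space p) = UNIV"
  by (simp add: trajectory_space_def space_pair_measure space_PiM)

text \<open>Lets events that depend on the clocks alone be evaluated in \<open>clock_space\<close>,
  whatever the initial distribution.\<close>

lemma distr_trajectory_space_snd:
  "distr (trajectory_space p) clock_space snd = clock_space"
proof (rule measure_eqI)
  interpret C: prob_space clock_space by (rule prob_space_clock_space)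
  fix A assume "A \<in> sets (distr (trajectory_space p) clock_space snd)"
  then have A: "A \<in> sets clock_space"
    by simp
  have "snd -` A \<inter> space (measure_pmf p \<Otimes>\<^sub>M clock_space) = space (measure_pmf p) \<times> A"
    using sets.sets_into_space[OF A] by (auto simp: space_pair_measure)
  then show "emeasure (distr (trajectory_space p) clock_space snd) A = emeasure clock_space A"
    using A measure_pmf.emeasure_space_1[of p] unfolding trajectory_space_def
    by (simp add: emeasure_distr C.emeasure_pair_measure_Times)
qed simp


subsection \<open>Measurability\<close>

lemma measurable_waiting_time [measurable]:
  "(\<lambda>e. waiting_time \<pi> z e a) \<in> borel_measurable (\<Pi>\<^sub>M a \<in> UNIV. borel)"
  unfolding waiting_time_def Let_def by measurable

text \<open>\<open>ARG_MIN\<close> is a Hilbert choice from the set \<open>A e\<close> of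
  minimizers. There are finitely many possible sets, each attained on a measurable event, and any
  choice function on this discrete space is measurable.\<close>

lemma measurable_next_clockwork [measurable]:
  fixes \<pi> :: "('g::finite, 'm) policy"
  shows "next_clockwork \<pi> z \<in> (\<Pi>\<^sub>M a \<in> UNIV. borel) \<rightarrow>\<^sub>M count_space UNIV"
proof -
  let ?B = "(\<Pi>\<^sub>M a \<in> UNIV. borel) :: ('g \<Rightarrow> real) measure"
  define A where "A e = {a. is_arg_min (waiting_time \<pi> z e) (\<lambda>_. True) a}" for e
  have "A \<in> ?B \<rightarrow>\<^sub>M count_space UNIV"
    unfolding measurable_count_space_eq2_countable
  proof (intro conjI ballI)
    fix S :: "'g set"
    have "A -` {S} \<inter> space ?B = {e \<in> space ?B. \<forall>a. a \<in> S \<longleftrightarrow>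
        (\<forall>b. \<not> waiting_time \<pi> z e b < waiting_time \<pi> z e a)}"
      by (auto simp: A_def is_arg_min_def)
    also have "\<dots> \<in> sets ?B"
      by measurable
    finally show "A -` {S} \<inter> space ?B \<in> sets ?B" .
  qed simp
  then have "(\<lambda>e. SOME a. a \<in> A e) \<in> ?B \<rightarrow>\<^sub>M count_space UNIV"
    by (rule measurable_compose) simp
  then show ?thesis
    by (simp add: next_clockwork_def[abs_def] arg_min_def A_def)
qed

context
  fixes \<pi> :: "('g::finite, 'm::countable) policy"
    and M :: "(('g, 'm) state \<times> (nat \<Rightarrow> 'g \<Rightarrow> real)) measure"
  assumes M [measurable_cong]:
    "sets M = sets (count_space UNIV \<Otimes>\<^sub>M (\<Pi>\<^sub>M n \<in> UNIV. \<Pi>\<^sub>M a \<in> UNIV. borel))"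
begin

text \<open>The state space is countable, so the state after \<open>n\<close> jumps can be frozen at
  a value \<open>z\<close>; the next state then depends on the clocks alone.\<close>

lemma measurable_jump_chain [measurable]:
  "(\<lambda>\<omega>. jump_chain \<pi> \<omega> n) \<in> M \<rightarrow>\<^sub>M count_space UNIV"
proof (induction n)
  case (Suc n)
  note [measurable] = Suc
  have [measurable]: "(\<lambda>\<omega>. jump \<pi> (next_clockwork \<pi> z (snd \<omega> n)) z) \<in> M \<rightarrow>\<^sub>M count_space UNIV" for z
    by (rule measurable_compose[where N = "count_space UNIV" and g = "\<lambda>a. jump \<pi> a z"]) measurable
  show ?case
    unfolding jump_chain.simps
    by (rule measurable_compose_countable[where f = "\<lambda>z \<omega>. jump \<pi> (next_clockwork \<pi> z (snd \<omega> n)) z"])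
      measurable
qed simp

lemma measurable_next_clockwork_jump_chain [measurable]:
  "(\<lambda>\<omega>. next_clockwork \<pi> (jump_chain \<pi> \<omega> n) (snd \<omega> n)) \<in> M \<rightarrow>\<^sub>M count_space UNIV"
  by (rule measurable_compose_countable[where f = "\<lambda>z \<omega>. next_clockwork \<pi> z (snd \<omega> n)"]) measurable

lemma measurable_jump_time [measurable]:
  "(\<lambda>\<omega>. jump_time \<pi> \<omega> n) \<in> borel_measurable M"
proof -
  have [measurable]: "(\<lambda>\<omega>. MIN a. waiting_time \<pi> (jump_chain \<pi> \<omega> k) (snd \<omega> k) a) \<in> borel_measurable M"
    for k
    by (rule measurable_compose_countable[where
          f = "\<lambda>z \<omega>. MIN a. waiting_time \<pi> z (snd \<omega> k) a"]) measurable
  show ?thesis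
    unfolding jump_time_def by measurable
qed

lemma measurable_state_at: "state_at \<pi> t \<in> M \<rightarrow>\<^sub>M count_space UNIV"
  unfolding state_at_def[abs_def]
  by (rule measurable_compose_countable[where f = "\<lambda>n \<omega>. jump_chain \<pi> \<omega> n"]) measurable

lemma measurable_integrated_current: "integrated_current \<pi> w t \<in> borel_measurable M"
proof -
  have [measurable]: "Measurable.pred M (\<lambda>\<omega>. fst (jump_chain \<pi> \<omega> n) a = i)"
    "Measurable.pred M (\<lambda>\<omega>. snd (jump_chain \<pi> \<omega> n) = m)" for n a i m
    by (rule measurable_compose[OF measurable_jump_chain], simp)+
  show ?thesis
    unfolding integrated_current_def[abs_def] jump_count_def by measurable
qed

end


subsection \<open>Constant policies with symmetric rates\<close>

text \<open>\<open>par\<close> ignores the memory, so waiting times agree at all states, even those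
  with memory outside \<open>mem\<close>, and the lemmas on them need no restriction on the
  state.\<close>

definition symmetric_policy :: "('g \<Rightarrow> real) \<Rightarrow> ('g, nat) policy" where
  "symmetric_policy \<Gamma> = \<lparr>mem = {0}, upd = \<lambda>_ _. 0, par = \<lambda>a _. (\<Gamma> a, \<Gamma> a)\<rparr>"

text \<open>Each flip of a single clockwork preserves this distribution, so it is stationary even if
  some rates vanish and the chain is not irreducible.\<close>

definition uniform_state :: "('g::finite, nat) state pmf" where
  "uniform_state = pmf_of_set (UNIV \<times> {0})"

lemma set_uniform_state: "set_pmf uniform_state = UNIV \<times> {0}"
  unfolding uniform_state_def by (rule set_pmf_of_set) auto

lemma waiting_time_symmetric:
  "waiting_time (symmetric_policy \<Gamma>) z e a = (if \<Gamma> a > 0 then ereal (e a / \<Gamma> a) else \<infinity>)"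
  by (simp add: waiting_time_def rate_def symmetric_policy_def)

lemma next_clockwork_symmetric:
  "next_clockwork (symmetric_policy \<Gamma>) z e = next_clockwork (symmetric_policy \<Gamma>) z' e"
  by (simp add: next_clockwork_def waiting_time_symmetric[abs_def])

lemma jump_time_symmetric:
  "jump_time (symmetric_policy \<Gamma>) (z, e) n = jump_time (symmetric_policy \<Gamma>) (z', e) n"
  by (simp add: jump_time_def waiting_time_symmetric)

text \<open>On the support a jump flips one bit and keeps the memory at 0. It is thus an involution,
  and bijections preserve uniform distributions.\<close>

lemma map_pmf_jump_uniform_state:
  "map_pmf (jump (symmetric_policy \<Gamma>) a) uniform_state = uniform_state"
  unfolding uniform_state_def
proof (rule map_pmf_of_set_bij_betw)
  have "(b :: bit) + 1 + 1 = b" for b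
    by (cases b) auto
  then show "bij_betw (jump (symmetric_policy \<Gamma>) a) (UNIV \<times> {0}) (UNIV \<times> {0})"
    by (intro bij_betw_byWitness[where f' = "jump (symmetric_policy \<Gamma>) a"])
      (auto simp: jump_def symmetric_policy_def)
qed auto

text \<open>For fixed clocks \<open>e\<close> the sequence of jumping clockworks is the same for
  every initial state, so the chain applies a fixed composition of flips.\<close>

lemma map_pmf_jump_chain_uniform_state:
  "map_pmf (\<lambda>z. jump_chain (symmetric_policy \<Gamma>) (z, e) n) uniform_state = uniform_state"
proof (induction n)
  case (Suc n)
  let ?J = "\<lambda>z. jump_chain (symmetric_policy \<Gamma>) (z, e) n"
  \<comment> \<open>\<open>undefined\<close> serves as an arbitrary reference state, which exhibits
    the choice as independent of \<open>z\<close>.\<close>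
  have "next_clockwork (symmetric_policy \<Gamma>) (?J z) (e n) =
      next_clockwork (symmetric_policy \<Gamma>) undefined (e n)" for z
    by (rule next_clockwork_symmetric)
  then have "map_pmf (\<lambda>z. jump_chain (symmetric_policy \<Gamma>) (z, e) (Suc n)) uniform_state =
      map_pmf (jump (symmetric_policy \<Gamma>) (next_clockwork (symmetric_policy \<Gamma>) undefined (e n)))
        (map_pmf ?J uniform_state)"
    by (simp add: pmf.map_comp comp_def)
  also have "\<dots> = uniform_state"
    by (simp add: Suc map_pmf_jump_uniform_state)
  finally show ?case .
qed simp

text \<open>
  The clocks do not see the state, so for fixed clocks the state at time \<open>t\<close> is a fixed
  permutation of the initial state.
\<close>

lemma steady_state_uniform_state:
  "steady_state (symmetric_policy \<Gamma>) (uniform_state :: ('g::finite, nat) state pmf)"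
  unfolding steady_state_def
proof (intro conjI allI impI)
  let ?\<pi> = "symmetric_policy \<Gamma>" and ?p = "uniform_state :: ('g, nat) state pmf"
  show "set_pmf ?p \<subseteq> UNIV \<times> mem ?\<pi>"
    by (simp add: set_uniform_state symmetric_policy_def)
  fix t :: real
  interpret p: prob_space "measure_pmf ?p" by (rule measure_pmf.prob_space_axioms)
  interpret C: prob_space "clock_space :: (nat \<Rightarrow> 'g \<Rightarrow> real) measure"
    by (rule prob_space_clock_space)
  interpret P: pair_sigma_finite "measure_pmf ?p" "clock_space :: (nat \<Rightarrow> 'g \<Rightarrow> real) measure" ..
  have state_at: "state_at ?\<pi> t \<in> trajectory_space ?p \<rightarrow>\<^sub>M count_space UNIV"
    by (rule measurable_state_at[OF sets_trajectory_space])
  show "distr (trajectory_space ?p) (count_space UNIV) (state_at ?\<pi> t) = measure_pmf ?p"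
  proof (rule measure_eqI)
    fix A :: "('g, nat) state set"
    have fibre: "emeasure ?p ((\<lambda>z. (z, e)) -` (state_at ?\<pi> t -` A)) = emeasure ?p A" for e
    proof -
      define n where "n = card {n. jump_time ?\<pi> (undefined, e) n \<le> ereal t}"
      have "state_at ?\<pi> t (z, e) = jump_chain ?\<pi> (z, e) n" for z
        by (simp add: state_at_def n_def jump_time_symmetric[of \<Gamma> z e _ undefined])
      then have "emeasure ?p ((\<lambda>z. (z, e)) -` (state_at ?\<pi> t -` A)) =
          emeasure (map_pmf (\<lambda>z. jump_chain ?\<pi> (z, e) n) ?p) A"
        by (simp add: vimage_def)
      then show ?thesis
        by (simp add: map_pmf_jump_chain_uniform_state)
    qed
    \<comment> \<open>Slicing along the clocks by Fubini: by \<open>fibre\<close> the integrand is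
      constant, and the clocks carry total mass 1.\<close>
    have "state_at ?\<pi> t -` A \<inter> space (trajectory_space ?p) \<in> sets (trajectory_space ?p)"
      by (rule measurable_sets[OF state_at]) simp
    then have "emeasure (trajectory_space ?p) (state_at ?\<pi> t -` A) =
        (\<integral>\<^sup>+e. emeasure ?p ((\<lambda>z. (z, e)) -` (state_at ?\<pi> t -` A)) \<partial>clock_space)"
      unfolding trajectory_space_def
      by (intro P.emeasure_pair_measure_alt2) (simp add: space_pair_measure space_PiM)
    then show "emeasure (distr (trajectory_space ?p) (count_space UNIV) (state_at ?\<pi> t)) A =
        emeasure ?p A"
      by (simp add: emeasure_distr state_at fibre C.emeasure_space_1)
  qed simp
qed


subsection \<open>The signal-to-noise ratio\<close>

lemma distributed_component:
  assumes "\<And>i. i \<in> I \<Longrightarrow> prob_space (M i)" "i \<in> I" "distributed (M i) N X f"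
  shows "distributed (PiM I M) N (\<lambda>\<omega>. X (\<omega> i)) f"
proof -
  have [measurable]: "X \<in> M i \<rightarrow>\<^sub>M N"
    using assms(3) by (simp add: distributed_def)
  have "distr (PiM I M) N (\<lambda>\<omega>. X (\<omega> i)) = distr (distr (PiM I M) (M i) (\<lambda>\<omega>. \<omega> i)) N X"
    using assms(2) by (subst distr_distr) (auto simp: comp_def)
  also have "\<dots> = density N f"
    using assms by (simp add: distr_PiM_component distributed_def)
  finally show ?thesis
    using assms by (auto simp: distributed_def)
qed

text \<open>Clockworks of rate zero never jump and are left out, which keeps the value real. It is
  meaningful only if some rate is positive.\<close>

definition shortest_wait :: "('g::finite \<Rightarrow> real) \<Rightarrow> ('g \<Rightarrow> real) \<Rightarrow> real" where
  "shortest_wait \<Gamma> e = Min ((\<lambda>a. e a / \<Gamma> a) ` {a. 0 < \<Gamma> a})"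

context
  fixes \<Gamma> :: "'g::finite \<Rightarrow> real"
  assumes nonneg: "\<And>a. 0 \<le> \<Gamma> a"
begin

lemma sum_positive_rates: "(\<Sum>a\<in>{a. 0 < \<Gamma> a}. \<Gamma> a) = (\<Sum>a\<in>UNIV. \<Gamma> a)"
  by (rule sum.mono_neutral_left) (auto simp: not_less intro: antisym nonneg)

text \<open>Once some rate is positive, the infinite waiting times cannot attain the minimum, so it
  can be taken among reals.\<close>

lemma jump_time_symmetric_eq:
  assumes "0 < (\<Sum>a\<in>UNIV. \<Gamma> a)"
  shows "jump_time (symmetric_policy \<Gamma>) \<omega> n = ereal (\<Sum>k\<le>n. shortest_wait \<Gamma> (snd \<omega> k))"
proof -
  have ne: "{a. 0 < \<Gamma> a} \<noteq> {}"
    using assms sum_positive_rates by fastforce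
  have "(MIN a. waiting_time (symmetric_policy \<Gamma>) z e a) = ereal (shortest_wait \<Gamma> e)" for z e
  proof (rule Min_eqI)
    have "shortest_wait \<Gamma> e \<in> (\<lambda>a. e a / \<Gamma> a) ` {a. 0 < \<Gamma> a}"
      unfolding shortest_wait_def using ne by (intro Min_in) auto
    then show "ereal (shortest_wait \<Gamma> e) \<in> range (waiting_time (symmetric_policy \<Gamma>) z e)"
      by (force simp: waiting_time_symmetric image_iff)
    fix y assume "y \<in> range (waiting_time (symmetric_policy \<Gamma>) z e)"
    then show "ereal (shortest_wait \<Gamma> e) \<le> y"
      by (auto simp: waiting_time_symmetric shortest_wait_def)
  qed simp
  then show ?thesis
    by (simp add: jump_time_def)
qed

lemma jump_time_symmetric_eq_infinity:
  assumes "(\<Sum>a\<in>UNIV. \<Gamma> a) = 0"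
  shows "jump_time (symmetric_policy \<Gamma>) \<omega> n = \<infinity>"
proof -
  have "\<Gamma> a = 0" for a
    using assms nonneg by (simp add: sum_nonneg_eq_0_iff)
  then show ?thesis
    by (auto simp: jump_time_def waiting_time_symmetric sum_Pinfty intro: exI[of _ n])
qed

text \<open>Dividing a standard exponential variable by \<open>\<Gamma> a\<close> gives it rate
  \<open>\<Gamma> a\<close>, and the minimum of independent exponential variables has the sum of
  their rates as its rate.\<close>

lemma distributed_shortest_wait:
  assumes R: "0 < (\<Sum>a\<in>UNIV. \<Gamma> a)"
  shows "distributed exp_clocks lborel (shortest_wait \<Gamma>)
    (exponential_density (\<Sum>a\<in>UNIV. \<Gamma> a))"
proof -
  interpret prob_space "exp_clocks :: ('g \<Rightarrow> real) measure"
    by (rule prob_space_exp_clocks)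
  have "distributed exp_clock lborel (\<lambda>x. x) (exponential_density 1)"
    by (simp add: distributed_def distr_id2)
  then have *: "distributed exp_clocks lborel (\<lambda>e. e a) (exponential_density 1)" for a :: 'g
    by (intro distributed_component prob_space_exp_clock) auto
  have "distributed exp_clocks lborel (\<lambda>e. e a / \<Gamma> a) (exponential_density (\<Gamma> a))"
    if "0 < \<Gamma> a" for a
    using erlang_distributed_mult_const[OF *, of "1 / \<Gamma> a"] that by simp
  moreover have "indep_vars (\<lambda>_. exp_clock) (\<lambda>a e. e a) (UNIV :: 'g set)"
    by (intro indep_vars_PiM_component prob_space_exp_clock) auto
  then have "indep_vars (\<lambda>_. borel) (\<lambda>a e. e a / \<Gamma> a) UNIV"
    by (rule indep_vars_compose2) measurable
  then have "indep_vars (\<lambda>_. borel) (\<lambda>a e. e a / \<Gamma> a) {a. 0 < \<Gamma> a}"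
    by (rule indep_vars_subset) simp
  moreover have "{a. 0 < \<Gamma> a} \<noteq> {}"
    using R sum_positive_rates by fastforce
  ultimately have "distributed exp_clocks lborel (\<lambda>e. Min ((\<lambda>a. e a / \<Gamma> a) ` {a. 0 < \<Gamma> a}))
      (exponential_density (\<Sum>a\<in>{a. 0 < \<Gamma> a}. \<Gamma> a))"
    by (intro exponential_distributed_Min) auto
  then show ?thesis
    by (simp add: shortest_wait_def[abs_def] sum_positive_rates)
qed

lemma indep_shortest_wait:
  "prob_space.indep_vars clock_space (\<lambda>_. borel) (\<lambda>k e. shortest_wait \<Gamma> (e k)) UNIV"
proof -
  interpret prob_space "clock_space :: (nat \<Rightarrow> 'g \<Rightarrow> real) measure"
    by (rule prob_space_clock_space)
  have "indep_vars (\<lambda>_. exp_clocks) (\<lambda>k e. e k) (UNIV :: nat set)"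
    by (intro indep_vars_PiM_component prob_space_exp_clocks) auto
  then show ?thesis
    by (rule indep_vars_compose2) (unfold shortest_wait_def, measurable)
qed

section \<open>Poisson law of the number of jumps\<close>

text \<open>The jump times are functions of the clocks alone, so both claims are transported along
  \<open>snd\<close> from \<open>exponential_arrivals\<close>, for any initial distribution.\<close>

lemma jumps_symmetric:
  fixes p :: "('g, nat) state pmf"
  assumes t: "0 \<le> t"
  defines "S \<equiv> \<lambda>\<omega>. {n. jump_time (symmetric_policy \<Gamma>) \<omega> n \<le> ereal t}"
    and "M \<equiv> trajectory_space p" and "R \<equiv> \<Sum>a\<in>UNIV. \<Gamma> a"
  shows "AE \<omega> in M. finite (S \<omega>)"
    and "measure M {\<omega> \<in> space M. card (S \<omega>) = n} = (R * t) ^ n / fact n * exp (- (R * t))"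
proof -
  interpret M: prob_space M
    unfolding M_def by (rule prob_space_trajectory_space)
  interpret C: prob_space "clock_space :: (nat \<Rightarrow> 'g \<Rightarrow> real) measure"
    by (rule prob_space_clock_space)
  have snd: "snd \<in> M \<rightarrow>\<^sub>M clock_space"
    unfolding M_def trajectory_space_def by measurable
  have distr: "distr M clock_space snd = clock_space"
    unfolding M_def by (rule distr_trajectory_space_snd)
  have "(AE \<omega> in M. finite (S \<omega>)) \<and>
    measure M {\<omega> \<in> space M. card (S \<omega>) = n} = (R * t) ^ n / fact n * exp (- (R * t))"
  \<comment> \<open>With total rate zero there are no jumps, and since \<open>0 ^ 0 = 1\<close> the
    Poisson formula is the point mass at 0.\<close>
  proof (cases "R = 0")
    case True
    then have "S \<omega> = {}" for \<omega>
      by (simp add: S_def R_def jump_time_symmetric_eq_infinity)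
    with True show ?thesis
      using M.prob_space by (cases n) simp_all
  next
    case False
    then have R: "0 < R"
      using nonneg by (simp add: R_def sum_nonneg less_le)
    define A where "A e = {n. (\<Sum>k\<le>n. shortest_wait \<Gamma> (e k)) \<le> t}" for e :: "nat \<Rightarrow> 'g \<Rightarrow> real"
    have S: "S \<omega> = A (snd \<omega>)" for \<omega>
      using R by (simp add: S_def A_def R_def jump_time_symmetric_eq)
    have "distributed clock_space lborel (\<lambda>e. shortest_wait \<Gamma> (e k)) (exponential_density R)" for k
      using distributed_shortest_wait R unfolding R_def
      by (intro distributed_component prob_space_exp_clocks) auto
    note * = C.exponential_arrivals[OF R t this indep_shortest_wait, folded A_def]
    have "AE \<omega> in M. finite (S \<omega>)"
      unfolding S using *(2) by (intro AE_distrD[OF snd]) (simp only: distr)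
    moreover have "measure M {\<omega> \<in> space M. card (S \<omega>) = n} =
        measure (distr M clock_space snd) {e \<in> space clock_space. card (A e) = n}"
      using measurable_space[OF snd] *(1)
      by (subst measure_distr[OF snd]) (auto simp: S intro!: arg_cong[where f = "measure M"])
    ultimately show ?thesis
      by (simp only: distr *(3) simp_thms)
  qed
  then show "AE \<omega> in M. finite (S \<omega>)"
    and "measure M {\<omega> \<in> space M. card (S \<omega>) = n} = (R * t) ^ n / fact n * exp (- (R * t))"
    by auto
qed

end

text \<open>With unit weights every jump is counted once, under its unique type. The exceptional
  null sets are a nonzero initial memory, whose first jump would be missed, and infinitely many
  jumps, for which cardinalities do not add up.\<close>

lemma AE_integrated_current_symmetric:
  fixes \<Gamma> :: "'g::finite \<Rightarrow> real"
  assumes "\<And>a. 0 \<le> \<Gamma> a" "0 \<le> t"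
  shows "AE \<omega> in trajectory_space uniform_state. integrated_current (symmetric_policy \<Gamma>) (\<lambda>_ _ _. 1) t \<omega> =
    real (card {n. jump_time (symmetric_policy \<Gamma>) \<omega> n \<le> ereal t})"
proof -
  let ?\<pi> = "symmetric_policy \<Gamma>" and ?p = "uniform_state :: ('g, nat) state pmf"
  interpret C: prob_space "clock_space :: (nat \<Rightarrow> 'g \<Rightarrow> real) measure"
    by (rule prob_space_clock_space)
  have "AE z in ?p. snd z = 0"
    by (auto simp: AE_measure_pmf_iff set_uniform_state)
  moreover have "distr (trajectory_space ?p) (measure_pmf ?p) fst = measure_pmf ?p"
    unfolding trajectory_space_def by (rule C.distr_pair_fst)
  ultimately have "AE z in distr (trajectory_space ?p) (measure_pmf ?p) fst. snd z = 0"
    by (simp only:)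
  moreover have "fst \<in> trajectory_space ?p \<rightarrow>\<^sub>M measure_pmf ?p"
    unfolding trajectory_space_def by (rule measurable_fst)
  ultimately have "AE \<omega> in trajectory_space ?p. snd (fst \<omega>) = 0"
    by (rule AE_distrD[rotated])
  moreover have "AE \<omega> in trajectory_space ?p. finite {n. jump_time ?\<pi> \<omega> n \<le> ereal t}"
    using assms by (rule jumps_symmetric)
  ultimately show ?thesis
  proof eventually_elim
    case (elim \<omega>)
    let ?S = "{n. jump_time ?\<pi> \<omega> n \<le> ereal t}"
    define c where "c n = next_clockwork ?\<pi> (jump_chain ?\<pi> \<omega> n) (snd \<omega> n)" for n
    define h where "h n = (c n, fst (jump_chain ?\<pi> \<omega> n) (c n))" for n
    have UNIV_bit: "UNIV = {0, 1 :: bit}"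
      using bit_not_zero_iff by blast
    have memory: "snd (jump_chain ?\<pi> \<omega> n) = 0" for n
      using elim by (cases n) (simp_all add: jump_def symmetric_policy_def)
    have "integrated_current ?\<pi> (\<lambda>_ _ _. 1) t \<omega> =
        (\<Sum>a\<in>UNIV. \<Sum>i\<in>UNIV. real (card {n \<in> ?S. h n = (a, i)}))"
      unfolding integrated_current_def UNIV_bit[symmetric] jump_count_def memory
      by (intro sum.cong refl)
        (auto simp: symmetric_policy_def h_def c_def intro!: arg_cong[where f = card])
    also have "\<dots> = (\<Sum>y\<in>UNIV. \<Sum>n\<in>{n \<in> ?S. h n = y}. 1)"
      by (simp add: sum.cartesian_product UNIV_Times_UNIV case_prod_beta)
    \<comment> \<open>The fibres of \<open>h\<close> partition the finite set of jumps by
      type.\<close>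
    also have "\<dots> = (\<Sum>n\<in>?S. 1)"
      using elim by (intro sum.group) auto
    finally show ?case
      by simp
  qed
qed

text \<open>Mean and variance both equal \<open>R * t\<close>, so the ratio has the value
  \<open>R\<close> at every positive time and the limit is that of an eventually constant
  function.\<close>

lemma has_asymptotic_snr_symmetric:
  fixes \<Gamma> :: "'g::finite \<Rightarrow> real"
  assumes nonneg: "\<And>a. 0 \<le> \<Gamma> a"
  shows "has_asymptotic_snr (trajectory_space uniform_state)
    (integrated_current (symmetric_policy \<Gamma>) (\<lambda>_ _ _. 1)) (\<Sum>a\<in>UNIV. \<Gamma> a)"
proof -
  let ?M = "trajectory_space (uniform_state :: ('g, nat) state pmf)"
  let ?N = "integrated_current (symmetric_policy \<Gamma>) (\<lambda>_ _ _. 1)"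
  define R where "R = (\<Sum>a\<in>UNIV. \<Gamma> a)"
  interpret prob_space ?M
    by (rule prob_space_trajectory_space)
  have moments: "integrable ?M (?N t) \<and> integrable ?M (\<lambda>\<omega>. (?N t \<omega>)\<^sup>2) \<and>
      expectation (?N t) = R * t \<and> variance (?N t) = R * t" if t: "0 \<le> t" for t
  proof -
    define K where "K \<omega> = card {n. jump_time (symmetric_policy \<Gamma>) \<omega> n \<le> ereal t}" for \<omega>
    note [measurable] = measurable_jump_time[OF sets_trajectory_space]
      measurable_integrated_current[OF sets_trajectory_space]
    have K[measurable]: "K \<in> ?M \<rightarrow>\<^sub>M count_space UNIV"
      unfolding K_def by measurable
    have AE: "AE \<omega> in ?M. ?N t \<omega> = real (K \<omega>)"
      unfolding K_def by (rule AE_integrated_current_symmetric[OF nonneg t])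
    have "prob {\<omega> \<in> space ?M. K \<omega> = n} = (R * t) ^ n / fact n * exp (- (R * t))" for n
      unfolding K_def R_def by (rule jumps_symmetric(2)[OF nonneg t])
    note K_moments = poisson_moments[OF K this]
    have E: "expectation (?N t) = expectation (\<lambda>\<omega>. real (K \<omega>))"
      using AE by (intro integral_cong_AE) auto
    have "variance (?N t) = variance (\<lambda>\<omega>. real (K \<omega>))"
      unfolding E using AE by (intro integral_cong_AE) auto
    moreover have "integrable ?M (?N t) \<longleftrightarrow> integrable ?M (\<lambda>\<omega>. real (K \<omega>))"
      using AE by (intro integrable_cong_AE) auto
    moreover have "integrable ?M (\<lambda>\<omega>. (?N t \<omega>)\<^sup>2) \<longleftrightarrow> integrable ?M (\<lambda>\<omega>. (real (K \<omega>))\<^sup>2)"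
      using AE by (intro integrable_cong_AE) auto
    ultimately show ?thesis
      using K_moments E by simp
  qed
  have deriv: "((\<lambda>s. expectation (?N s)) has_real_derivative R) (at t)" if "0 < t" for t
  \<comment> \<open>The mean is known only for nonnegative times, so it is compared with
    \<open>R * s\<close> on the open half-line around \<open>t\<close>.\<close>
  proof (rule has_field_derivative_transform_within_open)
    show "((\<lambda>s. R * s) has_real_derivative R) (at t)"
      by (auto intro!: derivative_eq_intros)
    show "open {0::real<..}" "t \<in> {0<..}"
      using that by auto
  qed (use moments in auto)
  have snr: "snr_at ?M ?N t = ereal R" if "0 < t" for t
  proof -
    have "variance (?N t) = R * t"
      using moments that by (blast intro: less_imp_le)
    then have "snr_at ?M ?N t = ereal (R\<^sup>2) / ereal (R * t / t)"
      by (simp only: snr_at_def DERIV_imp_deriv[OF deriv[OF that]])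
    \<comment> \<open>For \<open>R = 0\<close> the quotient is \<open>0 / 0\<close>, which is 0 in
      \<open>ereal\<close> and so again equals \<open>R\<close>.\<close>
    then show ?thesis
      using that by (cases "R = 0") (simp_all add: power2_eq_square)
  qed
  have "(snr_at ?M ?N \<longlongrightarrow> ereal R) at_top"
    using snr by (intro tendsto_eventually eventually_mono[OF eventually_gt_at_top[of 0]])
  then show ?thesis
    unfolding has_asymptotic_snr_def R_def[symmetric]
    using moments deriv unfolding real_differentiable_def by blast
qed

section \<open>Choice of the constant policy\<close>

theorem corollary3:
  fixes \<G> :: "'g::finite \<Rightarrow> (real \<times> real) set"
    and \<G>' :: "'g \<Rightarrow> real set"
    and \<pi> :: "('g, 'm) policy"
  assumes "\<And>a. \<G> a = \<G>' a \<times> \<G>' a"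
    and "\<And>a. \<G>' a \<noteq> {0}"
    and "\<And>a. \<G>' a \<subseteq> {0..}"
    and "feedback_policy \<G> \<pi>"
  shows "\<exists>(\<pi>' :: ('g, nat) policy) w p.
           feedback_policy \<G> \<pi>' \<and> constant_policy \<pi>' \<and> steady_state \<pi>' p \<and>
           has_asymptotic_snr (trajectory_space p) (integrated_current \<pi>' w)
             (MAX m\<in>mem \<pi>. MAX i. \<Sum>a\<in>UNIV. rate \<pi> a (i a) m)"
proof -
  let ?r = "\<lambda>m i. \<Sum>a\<in>UNIV. rate \<pi> a (i a) m"
  have mem: "finite (mem \<pi>)" "mem \<pi> \<noteq> {}"
    and par: "\<And>a m. m \<in> mem \<pi> \<Longrightarrow> par \<pi> a m \<in> \<G> a"
    using assms(4) by (auto simp: feedback_policy_def)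
  \<comment> \<open>Both maxima range over finite nonempty sets and are therefore attained.\<close>
  have "(MAX m\<in>mem \<pi>. MAX i. ?r m i) \<in> (\<lambda>m. MAX i. ?r m i) ` mem \<pi>"
    using mem by (intro Max_in) auto
  then obtain m where m: "m \<in> mem \<pi>" "(MAX m\<in>mem \<pi>. MAX i. ?r m i) = (MAX i. ?r m i)"
    by auto
  have "(MAX i. ?r m i) \<in> range (?r m)"
    by (intro Max_in) auto
  then obtain i where i: "(MAX i. ?r m i) = ?r m i"
    by (rule rangeE)
  \<comment> \<open>Each clockwork uses the rate of its maximizing state in both states. As
    \<open>\<G> a\<close> is a square, the pair is admissible once \<open>\<Gamma> a\<close> lies in
    \<open>\<G>' a\<close>.\<close>
  define \<Gamma> where "\<Gamma> a = rate \<pi> a (i a) m" for a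
  have \<Gamma>: "\<Gamma> a \<in> \<G>' a" for a
    using par[OF m(1), of a] by (auto simp: \<Gamma>_def rate_def assms(1) mem_Times_iff)
  then have "0 \<le> \<Gamma> a" for a
    using assms(3) by fastforce
  then have "has_asymptotic_snr (trajectory_space uniform_state)
      (integrated_current (symmetric_policy \<Gamma>) (\<lambda>_ _ _. 1)) (MAX m\<in>mem \<pi>. MAX i. ?r m i)"
    using has_asymptotic_snr_symmetric[of \<Gamma>] by (simp add: m i \<Gamma>_def)
  moreover have "feedback_policy \<G> (symmetric_policy \<Gamma>)"
    using \<Gamma> by (simp add: feedback_policy_def symmetric_policy_def assms(1))
  moreover have "constant_policy (symmetric_policy \<Gamma>)"
    by (simp add: constant_policy_def symmetric_policy_def)
  ultimately show ?thesis
    using steady_state_uniform_state by blast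
qed

end
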